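(* If $f:\{0,1\}^n\to\{0,1\}$ is any anti-monotone conjunction, then the following algorithm accepts $f$ with probability $1$ (for any choice of $\varepsilon>0$ and positive constants $c_1,c_2$). Phase 1: repeat $c_1/\varepsilon$ times: draw $x,y\sim\mathrm{Samp}(f)$; if $f(x\oplus y)=0$, halt and reject. Phase 2: repeat $c_2$ times: draw $x\sim\mathrm{Samp}(f)$, draw $y$ uniformly from $\{y:y\preceq x\}$, draw $u\sim\mathrm{Samp}(f)$; if $f(y\oplus u)=0$, halt and reject. Finally, accept.
   Context: An anti-monotone conjunction is a conjunction of negated variables. $y\preceq x$ means $y_i\le x_i$ for all $i$; $\oplus$ is coordinatewise XOR. $\mathrm{Samp}(f)$ returns an independent uniformly random element of $f^{-1}(1)$; values $f(\cdot)$ are obtained via membership queries. *)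

theory Defs
  imports "HOL-Probability.Probability_Mass_Function"
begin

text \<open>The points of the cube of dimension \<open>n\<close> are the lists of type \<open>bool list\<close> with length
  \<open>n\<close>, where \<open>True\<close> stands for 1. A function on the cube has type \<open>bool list \<Rightarrow> bool\<close>; only its
  values on lists of length \<open>n\<close> are relevant.\<close>

definition cube :: "nat \<Rightarrow> bool list set" where
  "cube n = {x. length x = n}"

definition xor_vec :: "bool list \<Rightarrow> bool list \<Rightarrow> bool list"  (infixl \<open>\<oplus>\<close> 65) where
  "x \<oplus> y = map2 (\<noteq>) x y"

text \<open>On \<open>bool\<close>, \<open>False \<le> True\<close>; moreover \<open>list_all2\<close> forces equal lengths.\<close>

definition below :: "bool list \<Rightarrow> bool list \<Rightarrow> bool"  (infix \<open>\<preceq>\<close> 50) where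
  "y \<preceq> x \<longleftrightarrow> list_all2 (\<le>) y x"

text \<open>The set \<open>S\<close> of negated variables may be empty: the constant 1 is the empty conjunction.\<close>

definition anti_monotone_conjunction :: "nat \<Rightarrow> (bool list \<Rightarrow> bool) \<Rightarrow> bool" where
  "anti_monotone_conjunction n f \<longleftrightarrow>
     (\<exists>S \<subseteq> {..<n}. \<forall>x \<in> cube n. f x \<longleftrightarrow> (\<forall>i\<in>S. \<not> x ! i))"

text \<open>Meaningful only if \<open>f\<close> is satisfiable on the cube, since \<open>pmf_of_set {}\<close> is unspecified.
  Every anti-monotone conjunction is satisfied by the zero vector.\<close>

definition Samp :: "nat \<Rightarrow> (bool list \<Rightarrow> bool) \<Rightarrow> bool list pmf" where
  "Samp n f = pmf_of_set {x \<in> cube n. f x}"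

text \<open>Runs a randomized check up to \<open>k\<close> times with fresh randomness and halts with \<open>False\<close>
  (reject) at the first failure.\<close>

primrec repeat_check :: "nat \<Rightarrow> bool pmf \<Rightarrow> bool pmf" where
  "repeat_check 0 t = return_pmf True"
| "repeat_check (Suc k) t =
     do { b \<leftarrow> t; if b then repeat_check k t else return_pmf False }"

text \<open>The two checks and the tester get the function only through a sample oracle \<open>samp\<close> and a
  membership oracle \<open>mq\<close>. Each call of \<open>samp\<close> in the monad is an independent draw.\<close>

definition check1 :: "bool list pmf \<Rightarrow> (bool list \<Rightarrow> bool) \<Rightarrow> bool pmf" where
  "check1 samp mq = do {
     x \<leftarrow> samp;
     y \<leftarrow> samp;
     return_pmf (mq (x \<oplus> y)) }"

definition check2 :: "bool list pmf \<Rightarrow> (bool list \<Rightarrow> bool) \<Rightarrow> bool pmf" where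
  "check2 samp mq = do {
     x \<leftarrow> samp;
     y \<leftarrow> pmf_of_set {y. y \<preceq> x};
     u \<leftarrow> samp;
     return_pmf (mq (y \<oplus> u)) }"

text \<open>The output \<open>True\<close> means accept. The real repetition counts \<open>c1 / \<epsilon>\<close> and \<open>c2\<close> are rounded up.\<close>

definition tester ::
  "bool list pmf \<Rightarrow> (bool list \<Rightarrow> bool) \<Rightarrow> real \<Rightarrow> real \<Rightarrow> real \<Rightarrow> bool pmf" where
  "tester samp mq \<epsilon> c1 c2 = do {
     b \<leftarrow> repeat_check (nat \<lceil>c1 / \<epsilon>\<rceil>) (check1 samp mq);
     if b then repeat_check (nat \<lceil>c2\<rceil>) (check2 samp mq) else return_pmf False }"

end

(* The satisfying assignments of an anti-monotone conjunction form a linear subspace of the cube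
   that is closed downwards, so every point queried in either phase satisfies the conjunction. *)

theory Submission
  imports Defs
begin

text \<open>A point satisfies the conjunction iff its coordinates in a fixed set \<open>S\<close>
  are all 0. Zeros on \<open>S\<close> survive XOR of two such points
  (\<open>anti_monotone_conjunction_xor_vec\<close>) and switching off bits
  (\<open>anti_monotone_conjunction_below\<close>), so no possible outcome of the draws yields a
  query answered 0. Hence no probability has to be computed: it suffices to bound supports by
  \<open>{True}\<close>, for each check, then for its repetition, then for
  \<open>tester\<close>.\<close>

lemma finite_cube: "finite (cube n)"
  using finite_lists_length_eq[of "UNIV :: bool set" n] by (simp add: cube_def)

lemma xor_vec_in_cube: "x \<in> cube n \<Longrightarrow> y \<in> cube n \<Longrightarrow> x \<oplus> y \<in> cube n"
  by (simp add: cube_def xor_vec_def)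

lemma below_in_cube: "y \<preceq> x \<Longrightarrow> x \<in> cube n \<Longrightarrow> y \<in> cube n"
  by (simp add: cube_def below_def list_all2_lengthD)

text \<open>\<open>pmf_of_set\<close> has the intended support only on a finite nonempty set;
  \<open>x\<close> itself is the witness.\<close>

lemma set_pmf_of_below: "set_pmf (pmf_of_set {y. y \<preceq> x}) = {y. y \<preceq> x}"
proof (rule set_pmf_of_set)
  have "x \<preceq> x"
    by (simp add: below_def list_all2_refl)
  then show "{y. y \<preceq> x} \<noteq> {}" by blast
  have "{y. y \<preceq> x} \<subseteq> cube (length x)"
    using below_in_cube by (auto simp: cube_def)
  then show "finite {y. y \<preceq> x}"
    using finite_cube finite_subset by blast
qed

lemma set_pmf_Samp:
  assumes "anti_monotone_conjunction n f"
  shows "set_pmf (Samp n f) = {x \<in> cube n. f x}"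
  unfolding Samp_def
proof (rule set_pmf_of_set)
  have "replicate n False \<in> {x \<in> cube n. f x}"
    using assms by (fastforce simp: anti_monotone_conjunction_def cube_def)
  then show "{x \<in> cube n. f x} \<noteq> {}" by blast
  show "finite {x \<in> cube n. f x}"
    using finite_cube by simp
qed

lemma anti_monotone_conjunction_xor_vec:
  assumes "anti_monotone_conjunction n f"
    and "x \<in> cube n" "y \<in> cube n" and "f x" "f y"
  shows "f (x \<oplus> y)"
proof -
  obtain S where S: "S \<subseteq> {..<n}" "\<And>z. z \<in> cube n \<Longrightarrow> f z \<longleftrightarrow> (\<forall>i\<in>S. \<not> z ! i)"
    using assms(1) unfolding anti_monotone_conjunction_def by blast
  \<comment> \<open>Since \<open>S\<close> lies in \<open>{..<n}\<close>, the index is within both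
    lists, and the entry is \<open>False \<noteq> False\<close>.\<close>
  have "\<not> (x \<oplus> y) ! i" if "i \<in> S" for i
    using that S assms by (auto simp: cube_def xor_vec_def)
  then show ?thesis
    using S(2) xor_vec_in_cube assms by blast
qed

lemma anti_monotone_conjunction_below:
  assumes "anti_monotone_conjunction n f"
    and "x \<in> cube n" and "f x" and "y \<preceq> x"
  shows "f y"
proof -
  obtain S where S: "S \<subseteq> {..<n}" "\<And>z. z \<in> cube n \<Longrightarrow> f z \<longleftrightarrow> (\<forall>i\<in>S. \<not> z ! i)"
    using assms(1) unfolding anti_monotone_conjunction_def by blast
  have "\<not> y ! i" if "i \<in> S" for i
  proof -
    have "i < length y"
      using that S(1) below_in_cube[OF assms(4,2)] by (auto simp: cube_def)
    then have "y ! i \<le> x ! i"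
      using assms(4) unfolding below_def by (rule list_all2_nthD[rotated])
    \<comment> \<open>Here \<open>x ! i\<close> is \<open>False\<close>, the least truth
      value.\<close>
    then show ?thesis
      using that S(2) assms by auto
  qed
  then show ?thesis
    using S(2) below_in_cube assms by blast
qed

lemma set_pmf_check1:
  assumes "anti_monotone_conjunction n f"
  shows "set_pmf (check1 (Samp n f) f) \<subseteq> {True}"
proof -
  have "f (x \<oplus> y)" if "x \<in> set_pmf (Samp n f)" "y \<in> set_pmf (Samp n f)" for x y
    using that anti_monotone_conjunction_xor_vec[OF assms]
    by (simp add: set_pmf_Samp[OF assms])
  then show ?thesis
    by (simp add: check1_def UN_subset_iff)
qed

text \<open>Downward closure makes \<open>y\<close> a satisfying point, which reduces this check to
  the XOR argument of the first one.\<close>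

lemma set_pmf_check2:
  assumes "anti_monotone_conjunction n f"
  shows "set_pmf (check2 (Samp n f) f) \<subseteq> {True}"
proof -
  have "f (y \<oplus> u)"
    if "x \<in> set_pmf (Samp n f)" "y \<preceq> x" "u \<in> set_pmf (Samp n f)" for x y u
  proof (rule anti_monotone_conjunction_xor_vec[OF assms])
    have x: "x \<in> cube n" "f x" and u: "u \<in> cube n" "f u"
      using that by (simp_all add: set_pmf_Samp[OF assms])
    show "y \<in> cube n" by (rule below_in_cube[OF that(2) x(1)])
    show "f y" by (rule anti_monotone_conjunction_below[OF assms x that(2)])
    show "u \<in> cube n" "f u" by (fact u)+
  qed
  then show ?thesis
    by (simp add: check2_def set_pmf_of_below UN_subset_iff)
qed

text \<open>The rejecting branch is never reached. The bound is uniform in \<open>k\<close>, so it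
  covers the rounded counts in \<open>tester\<close>.\<close>

lemma set_pmf_repeat_check:
  assumes "set_pmf t \<subseteq> {True}"
  shows "set_pmf (repeat_check k t) \<subseteq> {True}"
proof (induction k)
  case (Suc k)
  then show ?case
    using assms by (force simp: UN_subset_iff)
qed simp

theorem theorem3p8:
  fixes n :: nat and f :: "bool list \<Rightarrow> bool" and \<epsilon> c1 c2 :: real
  assumes "anti_monotone_conjunction n f"
    and "\<epsilon> > 0" and "c1 > 0" and "c2 > 0"
  shows "measure_pmf.prob (tester (Samp n f) f \<epsilon> c1 c2) {True} = 1"
proof -
  have "set_pmf (repeat_check k (check1 (Samp n f) f)) \<subseteq> {True}"
    and "set_pmf (repeat_check k (check2 (Samp n f) f)) \<subseteq> {True}" for k
    using assms(1) by (simp_all add: set_pmf_repeat_check set_pmf_check1 set_pmf_check2)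
  then have "set_pmf (tester (Samp n f) f \<epsilon> c1 c2) \<subseteq> {True}"
    unfolding tester_def set_bind_pmf by (intro UN_least) force
  then show ?thesis
    \<comment> \<open>Probability 1 means almost surely, which for a pmf means on the whole
      support.\<close>
    by (subst measure_pmf.prob_eq_1) (auto simp: AE_measure_pmf_iff)
qed

end
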